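(* Let $G$ be the incidence graph of an affine plane of order $k$ with $k \ge 3$. Then $\zeta(G) = k$.
   Context: An affine plane of order $k$ is a $\mathrm{BIBD}(k^2,k^2+k,k+1,k,1)$, i.e. a set $X$ of $k^2$ points with a collection of $k^2+k$ blocks of size $k$ such that every point lies in $k+1$ blocks and every pair of distinct points lies in exactly one block, whose blocks partition into parallel classes (sets of $k$ pairwise disjoint blocks covering $X$). Its incidence graph is the bipartite graph on $X \cup \mathcal{B}$ with $x \sim B$ iff $x \in B$. Localization game on a connected graph $G$ with $k$ cops: the robber chooses a starting vertex, invisible to the cops. Each round the cops choose any $k$ vertices (no adjacency restriction) and each learns its distance to the robber; the cops win if after finitely many rounds they determine the robber's vertex uniquely; otherwise the robber moves to a neighbour or stays. The robber knows the cops' strategy. $\zeta(G)$ is the least $k$ for which $k$ cops can guarantee capture. *)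

theory Defs
  imports Main "HOL-Library.Disjoint_Sets"
begin

text \<open>
  Since any two points lie in exactly one block and blocks have \<open>k\<close> points, repeated blocks
  are impossible for \<open>k \<ge> 2\<close>; so the collection of blocks is a set rather than a multiset.
\<close>

definition affine_plane :: "nat \<Rightarrow> 'a set \<Rightarrow> 'a set set \<Rightarrow> bool" where
  "affine_plane k X \<B> \<longleftrightarrow>
     finite X \<and> card X = k\<^sup>2 \<and>
     \<B> \<subseteq> Pow X \<and> card \<B> = k\<^sup>2 + k \<and>
     (\<forall>b\<in>\<B>. card b = k) \<and>
     (\<forall>x\<in>X. card {b\<in>\<B>. x \<in> b} = k + 1) \<and>
     (\<forall>x\<in>X. \<forall>y\<in>X. x \<noteq> y \<longrightarrow> (\<exists>!b. b \<in> \<B> \<and> x \<in> b \<and> y \<in> b)) \<and>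
     (\<exists>\<P>. partition_on \<B> \<P> \<and> (\<forall>C\<in>\<P>. card C = k \<and> disjoint C \<and> \<Union>C = X))"

text \<open>
  Graphs are given by a vertex set \<open>V\<close> and a symmetric irreflexive edge relation \<open>E\<close> on it.
  The vertex set of the incidence graph is the disjoint union \<open>X <+> \<B>\<close>.
\<close>

definition incidence_edges :: "'a set \<Rightarrow> 'a set set \<Rightarrow> ('a + 'a set) rel" where
  "incidence_edges X \<B> =
     {(Inl x, Inr b) | x b. x \<in> X \<and> b \<in> \<B> \<and> x \<in> b} \<union>
     {(Inr b, Inl x) | x b. x \<in> X \<and> b \<in> \<B> \<and> x \<in> b}"

text \<open>The length of a shortest walk; meaningful only for vertices in the same component.\<close>

definition graph_dist :: "'v rel \<Rightarrow> 'v \<Rightarrow> 'v \<Rightarrow> nat" where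
  "graph_dist E u v = (LEAST n. (u, v) \<in> E ^^ n)"

text \<open>
  In each round the cops see the list of the distances from their probes to the robber. A cop
  strategy maps the list of all answers received so far to the next list of probes. As the
  strategy is deterministic, the past probes are recoverable from the past answers.
\<close>

type_synonym 'v cop_strategy = "nat list list \<Rightarrow> 'v list"

definition is_cop_strategy :: "'v set \<Rightarrow> nat \<Rightarrow> 'v cop_strategy \<Rightarrow> bool" where
  "is_cop_strategy V m \<sigma> \<longleftrightarrow> (\<forall>h. length (\<sigma> h) = m \<and> set (\<sigma> h) \<subseteq> V)"

text \<open>\<open>r n\<close> is the position of the robber when the cops probe in round \<open>n\<close> (starting from 0).\<close>

definition robber_trajectory :: "'v set \<Rightarrow> 'v rel \<Rightarrow> (nat \<Rightarrow> 'v) \<Rightarrow> bool" where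
  "robber_trajectory V E r \<longleftrightarrow>
     (\<forall>n. r n \<in> V) \<and> (\<forall>n. r (Suc n) = r n \<or> (r n, r (Suc n)) \<in> E)"

primrec answers :: "'v rel \<Rightarrow> 'v cop_strategy \<Rightarrow> (nat \<Rightarrow> 'v) \<Rightarrow> nat \<Rightarrow> nat list list" where
  "answers E \<sigma> r 0 = []"
| "answers E \<sigma> r (Suc n) =
     answers E \<sigma> r n @ [map (\<lambda>c. graph_dist E c (r n)) (\<sigma> (answers E \<sigma> r n))]"

text \<open>
  The robber is located in round \<open>n\<close> if every robber trajectory that produces the same answers
  up to and including that round is at the same vertex.
\<close>

definition located :: "'v set \<Rightarrow> 'v rel \<Rightarrow> 'v cop_strategy \<Rightarrow> (nat \<Rightarrow> 'v) \<Rightarrow> nat \<Rightarrow> bool" where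
  "located V E \<sigma> r n \<longleftrightarrow>
     (\<forall>r'. robber_trajectory V E r' \<and> answers E \<sigma> r' (Suc n) = answers E \<sigma> r (Suc n)
        \<longrightarrow> r' n = r n)"

definition cops_win :: "'v set \<Rightarrow> 'v rel \<Rightarrow> nat \<Rightarrow> bool" where
  "cops_win V E m \<longleftrightarrow>
     (\<exists>\<sigma>. is_cop_strategy V m \<sigma> \<and>
        (\<forall>r. robber_trajectory V E r \<longrightarrow> (\<exists>n. located V E \<sigma> r n)))"

definition localization_number :: "'v set \<Rightarrow> 'v rel \<Rightarrow> nat" where
  "localization_number V E = (LEAST m. cops_win V E m)"

end

theory Submission imports Defs begin

text \<open>
  Upper bound. Suppose the robber is known to be on one of \<open>n\<close> points of a block. After his move
  the cops probe all but one of these points and \<open>k - n + 1\<close> concurrent blocks; unless located,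
  he is then on one of \<open>n\<close> blocks through a known point, as each of the concurrent blocks rules out
  its parallel through that point. From there the cops probe all but one of the \<open>n\<close> blocks and
  \<open>k - n + 1\<close> blocks of a parallel class that contains none of them, which leaves at most
  \<open>n - 1\<close> points of a single block.

  Lower bound. The robber alternates between blocks and points. Fewer than \<open>k\<close> probes cannot
  separate the \<open>k + 1\<close> blocks through a point, since every probe singles out at most one of them.
  If \<open>b\<close> and \<open>b'\<close> are two unseparated blocks, then fewer than \<open>k\<close> probes cannot separate
  the points of \<open>b \<union> b'\<close> either, and from a point the robber can reach a whole pencil again.
\<close>

section \<open>The localization game\<close>

definition closed_nbhd :: "'v rel \<Rightarrow> 'v set \<Rightarrow> 'v set" where
  "closed_nbhd E T = T \<union> E `` T"

lemma closed_nbhd_mono: "T \<subseteq> T' \<Longrightarrow> closed_nbhd E T \<subseteq> closed_nbhd E T'"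
  by (auto simp: closed_nbhd_def)

text \<open>
  Here \<open>S\<close> is the set of possible positions of the robber just before a probe.
\<close>

inductive cops_win_from :: "'v set \<Rightarrow> 'v rel \<Rightarrow> nat \<Rightarrow> 'v set \<Rightarrow> bool" for V E m where
  probe: "\<lbrakk>length c = m; set c \<subseteq> V;
    \<And>v. v \<in> S \<Longrightarrow>
      (\<forall>u\<in>S. (\<forall>x\<in>set c. graph_dist E x u = graph_dist E x v) \<longrightarrow> u = v) \<or>
      cops_win_from V E m
        (closed_nbhd E {u\<in>S. \<forall>x\<in>set c. graph_dist E x u = graph_dist E x v})\<rbrakk>
    \<Longrightarrow> cops_win_from V E m S"

lemma cops_win_from_antimono:
  "cops_win_from V E m S \<Longrightarrow> S' \<subseteq> S \<Longrightarrow> cops_win_from V E m S'"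
proof (induction arbitrary: S' rule: cops_win_from.induct)
  case (probe c S)
  show ?case
  proof (rule cops_win_from.probe[OF probe(1,2)])
    fix v assume "v \<in> S'"
    moreover have "closed_nbhd E {u \<in> S'. \<forall>x\<in>set c. graph_dist E x u = graph_dist E x v}
      \<subseteq> closed_nbhd E {u \<in> S. \<forall>x\<in>set c. graph_dist E x u = graph_dist E x v}"
      by (rule closed_nbhd_mono) (use probe.prems in auto)
    ultimately show "(\<forall>u\<in>S'. (\<forall>x\<in>set c. graph_dist E x u = graph_dist E x v) \<longrightarrow> u = v) \<or>
      cops_win_from V E m
        (closed_nbhd E {u\<in>S'. \<forall>x\<in>set c. graph_dist E x u = graph_dist E x v})"
      using probe(3)[of v] probe.prems by blast
  qed
qed

text \<open>
  Here \<open>T\<close> is the set of possible positions of the robber just after a probe.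
\<close>

definition cops_win_after :: "'v set \<Rightarrow> 'v rel \<Rightarrow> nat \<Rightarrow> 'v set \<Rightarrow> bool" where
  "cops_win_after V E m T \<longleftrightarrow>
     (\<forall>u\<in>T. \<forall>v\<in>T. u = v) \<or> cops_win_from V E m (closed_nbhd E T)"

lemma cops_win_after_antimono:
  "cops_win_after V E m T \<Longrightarrow> T' \<subseteq> T \<Longrightarrow> cops_win_after V E m T'"
  unfolding cops_win_after_def
  by (meson cops_win_from_antimono closed_nbhd_mono subsetD)

text \<open>Winning is antitone in the candidate set, so it suffices to bound the positions
  consistent with an answer by some \<open>T\<close>. Repeated probes give no information, which
  allows any nonempty set of at most \<open>m\<close> probes.\<close>

lemma cops_win_from_probe_set:
  assumes "finite M" "card M \<le> m" "M \<noteq> {}" "M \<subseteq> V"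
    and step: "\<And>v. v \<in> S \<Longrightarrow> \<exists>T. cops_win_after V E m T \<and>
      (\<forall>u\<in>S. (\<forall>x\<in>M. graph_dist E x u = graph_dist E x v) \<longrightarrow> u \<in> T)"
  shows "cops_win_from V E m S"
proof -
  obtain xs where xs: "set xs = M" "length xs = card M"
    using assms(1) by (metis finite_distinct_list distinct_card)
  obtain a where a: "a \<in> M" using assms(3) by blast
  define c where "c = xs @ replicate (m - card M) a"
  have c: "set c = M" "length c = m"
    using xs a assms(2) by (auto simp: c_def)
  show ?thesis
  proof (rule cops_win_from.probe[of c])
    fix v assume v: "v \<in> S"
    let ?K = "{u\<in>S. \<forall>x\<in>set c. graph_dist E x u = graph_dist E x v}"
    obtain T where T: "cops_win_after V E m T" "?K \<subseteq> T"
      using step[OF v] c by auto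
    have "cops_win_after V E m ?K"
      using T by (rule cops_win_after_antimono)
    then show "(\<forall>u\<in>S. (\<forall>x\<in>set c. graph_dist E x u = graph_dist E x v) \<longrightarrow> u = v) \<or>
      cops_win_from V E m (closed_nbhd E ?K)"
      unfolding cops_win_after_def using v by auto
  qed (use c assms(4) in auto)
qed

text \<open>\<open>answers\<close> grows at the end, whereas \<open>cops_win_from\<close> unfolds
  the first round. After the first answer, the game continues with the shifted robber against the
  strategy applied to extended histories.\<close>

lemma answers_Suc_shift:
  "answers E \<sigma> r (Suc n) =
    map (\<lambda>c. graph_dist E c (r 0)) (\<sigma> []) #
    answers E (\<lambda>h. \<sigma> (map (\<lambda>c. graph_dist E c (r 0)) (\<sigma> []) # h)) (\<lambda>i. r (Suc i)) n"
  by (induction n) auto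

lemma answers_cong:
  "(\<And>i. i < n \<Longrightarrow> r i = r' i) \<Longrightarrow> answers E \<sigma> r n = answers E \<sigma> r' n"
  by (induction n) auto

lemma robber_trajectory_Suc:
  "robber_trajectory V E r \<Longrightarrow> robber_trajectory V E (\<lambda>i. r (Suc i))"
  by (auto simp: robber_trajectory_def)

text \<open>The strategies for the candidate sets that can follow the first probe are glued into
  one, which selects among them by the first answer. Restricting all trajectories to starts in
  \<open>S\<close> makes the induction go through.\<close>

lemma cops_win_from_strategy:
  assumes "cops_win_from V E m S"
  shows "\<exists>\<sigma>. is_cop_strategy V m \<sigma> \<and>
    (\<forall>r. robber_trajectory V E r \<and> r 0 \<in> S \<longrightarrow>
      (\<exists>n. \<forall>r'. robber_trajectory V E r' \<and> r' 0 \<in> S \<and>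
        answers E \<sigma> r' (Suc n) = answers E \<sigma> r (Suc n) \<longrightarrow> r' n = r n))"
  using assms
proof (induction rule: cops_win_from.induct)
  case (probe c S)
  define sig where "sig v = map (\<lambda>x. graph_dist E x v) c" for v
  have sig_eq: "sig u = sig v \<longleftrightarrow> (\<forall>x\<in>set c. graph_dist E x u = graph_dist E x v)" for u v
    by (simp add: sig_def)
  define nxt where "nxt a = closed_nbhd E {u\<in>S. sig u = a}" for a
  define good where "good S \<sigma> \<longleftrightarrow> is_cop_strategy V m \<sigma> \<and>
    (\<forall>r. robber_trajectory V E r \<and> r 0 \<in> S \<longrightarrow>
      (\<exists>n. \<forall>r'. robber_trajectory V E r' \<and> r' 0 \<in> S \<and>
        answers E \<sigma> r' (Suc n) = answers E \<sigma> r (Suc n) \<longrightarrow> r' n = r n))" for S \<sigma>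
  have IH: "(\<forall>u\<in>S. sig u = sig v \<longrightarrow> u = v) \<or> (\<exists>\<sigma>. good (nxt (sig v)) \<sigma>)" if "v \<in> S" for v
    using probe(3)[OF that] unfolding good_def nxt_def sig_eq by blast
  \<comment> \<open>\<open>is_cop_strategy\<close> constrains every history, so a legal default is
    needed where no winning continuation exists. It is relevant only where the first answer already
    locates the robber.\<close>
  define \<tau> where "\<tau> a = (if \<exists>\<sigma>. good (nxt a) \<sigma> then SOME \<sigma>. good (nxt a) \<sigma> else (\<lambda>h. c))" for a
  have \<tau>_good: "good (nxt a) (\<tau> a)" if "\<exists>\<sigma>. good (nxt a) \<sigma>" for a
    using that someI_ex[OF that] by (simp add: \<tau>_def)
  have \<tau>_strat: "is_cop_strategy V m (\<tau> a)" for a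
    using \<tau>_good[of a] probe(1,2)
    by (cases "\<exists>\<sigma>. good (nxt a) \<sigma>") (auto simp: good_def \<tau>_def is_cop_strategy_def)
  define \<sigma> where "\<sigma> h = (case h of [] \<Rightarrow> c | a # h' \<Rightarrow> \<tau> a h')" for h
  have ans: "answers E \<sigma> r (Suc n) = sig (r 0) # answers E (\<tau> (sig (r 0))) (\<lambda>i. r (Suc i)) n" for r n
    unfolding answers_Suc_shift by (simp add: \<sigma>_def sig_def)
  have "good S \<sigma>"
    unfolding good_def
  proof (intro conjI allI impI)
    show "is_cop_strategy V m \<sigma>"
      using \<tau>_strat probe(1,2) by (auto simp: is_cop_strategy_def \<sigma>_def split: list.split)
  next
    fix r assume r: "robber_trajectory V E r \<and> r 0 \<in> S"
    show "\<exists>n. \<forall>r'. robber_trajectory V E r' \<and> r' 0 \<in> S \<and>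
        answers E \<sigma> r' (Suc n) = answers E \<sigma> r (Suc n) \<longrightarrow> r' n = r n"
    proof (cases "\<forall>u\<in>S. sig u = sig (r 0) \<longrightarrow> u = r 0")
      case True
      then show ?thesis by (intro exI[of _ 0]) (auto simp del: answers.simps simp: ans)
    next
      case False
      with IH r have g: "good (nxt (sig (r 0))) (\<tau> (sig (r 0)))"
        using \<tau>_good by blast
      have mem: "r' (Suc 0) \<in> nxt (sig (r' 0))" if "robber_trajectory V E r'" "r' 0 \<in> S" for r'
        using that unfolding robber_trajectory_def nxt_def closed_nbhd_def
        by (smt (verit, best) Image_iff UnCI mem_Collect_eq)
      obtain n where n: "\<forall>r'. robber_trajectory V E r' \<and> r' 0 \<in> nxt (sig (r 0)) \<and>
          answers E (\<tau> (sig (r 0))) r' (Suc n) =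
            answers E (\<tau> (sig (r 0))) (\<lambda>i. r (Suc i)) (Suc n) \<longrightarrow> r' n = r (Suc n)"
        using g[unfolded good_def, THEN conjunct2, THEN spec, of "\<lambda>i. r (Suc i)"]
          mem[of r] r robber_trajectory_Suc[of V E r] by (elim impE exE) auto
      show ?thesis
      proof (intro exI[of _ "Suc n"] allI impI)
        fix r' assume r': "robber_trajectory V E r' \<and> r' 0 \<in> S \<and>
          answers E \<sigma> r' (Suc (Suc n)) = answers E \<sigma> r (Suc (Suc n))"
        then have "sig (r' 0) = sig (r 0)"
          and "answers E (\<tau> (sig (r 0))) (\<lambda>i. r' (Suc i)) (Suc n) =
            answers E (\<tau> (sig (r 0))) (\<lambda>i. r (Suc i)) (Suc n)"
          unfolding ans by auto
        then show "r' (Suc n) = r (Suc n)"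
          using n[rule_format, of "\<lambda>i. r' (Suc i)"] r' mem[of r'] robber_trajectory_Suc[of V E r']
          by (simp del: answers.simps)
      qed
    qed
  qed
  then show ?case unfolding good_def by blast
qed

lemma cops_win_if_from:
  assumes "cops_win_from V E m V"
  shows "cops_win V E m"
proof -
  obtain \<sigma> where \<sigma>: "is_cop_strategy V m \<sigma>"
    "\<forall>r. robber_trajectory V E r \<and> r 0 \<in> V \<longrightarrow>
      (\<exists>n. \<forall>r'. robber_trajectory V E r' \<and> r' 0 \<in> V \<and>
        answers E \<sigma> r' (Suc n) = answers E \<sigma> r (Suc n) \<longrightarrow> r' n = r n)"
    using cops_win_from_strategy[OF assms] by (elim exE conjE)
  have start: "r 0 \<in> V" if "robber_trajectory V E r" for r
    using that by (simp add: robber_trajectory_def)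
  have "\<exists>n. located V E \<sigma> r n" if r: "robber_trajectory V E r" for r
    using \<sigma>(2)[rule_format, OF conjI[OF r start[OF r]]] start unfolding located_def by blast
  then show ?thesis
    using \<sigma>(1) unfolding cops_win_def by blast
qed

text \<open>Here \<open>g c\<close> is the usual answer of the probe \<open>c\<close>, and at most
  one element of \<open>A\<close> gets another answer from \<open>c\<close>. Discarding at most
  \<open>card P\<close> exceptional elements leaves two on which every probe gives its usual
  answer.\<close>

lemma unseparated_pair:
  assumes "finite P" "card P + 2 \<le> card A"
    and sep: "\<And>c a a'. c \<in> P \<Longrightarrow> a \<in> A \<Longrightarrow> a' \<in> A \<Longrightarrow> f c a \<noteq> g c \<Longrightarrow> f c a' \<noteq> g c \<Longrightarrow> a = a'"
  shows "\<exists>a\<in>A. \<exists>a'\<in>A. a \<noteq> a' \<and> (\<forall>c\<in>P. f c a = f c a')"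
proof -
  have finA: "finite A" using assms(2) by (intro card_ge_0_finite) simp
  let ?Z = "{a \<in> A. \<exists>c\<in>P. f c a \<noteq> g c}"
  have "\<forall>a\<in>?Z. \<exists>c. c \<in> P \<and> f c a \<noteq> g c" by blast
  then obtain h where h: "\<forall>a\<in>?Z. h a \<in> P \<and> f (h a) a \<noteq> g (h a)"
    by (rule bchoice[THEN exE])
  have "inj_on h ?Z"
  proof (rule inj_onI)
    fix a a' assume "a \<in> ?Z" "a' \<in> ?Z" "h a = h a'"
    then show "a = a'" using h sep[of "h a" a a'] by force
  qed
  then have "card ?Z \<le> card P"
    by (rule card_inj_on_le) (use h assms(1) in auto)
  moreover have "card (A - ?Z) = card A - card ?Z"
    using finA by (intro card_Diff_subset) auto
  ultimately have "\<not> card (A - ?Z) \<le> Suc 0" using assms(2) by linarith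
  then obtain a a' where "a \<in> A - ?Z" "a' \<in> A - ?Z" "a \<noteq> a'"
    using card_le_Suc0_iff_eq[of "A - ?Z"] finA by blast
  then show ?thesis by (intro bexI[of _ a] bexI[of _ a']) auto
qed

section \<open>Affine planes\<close>

locale affine_plane_order =
  fixes k :: nat and X :: "'a set" and \<B> :: "'a set set"
  assumes plane: "affine_plane k X \<B>" and order_ge_2: "k \<ge> 2"
begin

definition pencil :: "'a \<Rightarrow> 'a set set" where
  "pencil x = {b \<in> \<B>. x \<in> b}"

definition parallel_class :: "'a set set \<Rightarrow> bool" where
  "parallel_class C \<longleftrightarrow> C \<subseteq> \<B> \<and> card C = k \<and> disjoint C \<and> \<Union>C = X"

text \<open>Blocks count as parallel to themselves, so that the blocks parallel to a given one form
  exactly its parallel class.\<close>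

definition parallel :: "'a set \<Rightarrow> 'a set \<Rightarrow> bool" where
  "parallel b c \<longleftrightarrow> b = c \<or> b \<inter> c = {}"

abbreviation V :: "('a + 'a set) set" where "V \<equiv> X <+> \<B>"
abbreviation E :: "('a + 'a set) rel" where "E \<equiv> incidence_edges X \<B>"

lemma finite_points: "finite X"
  using plane by (simp add: affine_plane_def)

lemma block_subset: "b \<in> \<B> \<Longrightarrow> b \<subseteq> X"
  using plane by (auto simp: affine_plane_def)

lemma card_block: "b \<in> \<B> \<Longrightarrow> card b = k"
  using plane by (auto simp: affine_plane_def)

lemma finite_block: "b \<in> \<B> \<Longrightarrow> finite b"
  using block_subset finite_points finite_subset by blast

lemma finite_blocks: "finite \<B>"
  using finite_subset[of \<B> "Pow X"] block_subset finite_points by blast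

lemma points_nonempty: "X \<noteq> {}"
  using plane order_ge_2 by (auto simp: affine_plane_def)

lemma block_nonempty: "b \<in> \<B> \<Longrightarrow> b \<noteq> {}"
  using card_block[of b] order_ge_2 by auto

lemma card_pencil: "x \<in> X \<Longrightarrow> card (pencil x) = k + 1"
  using plane by (auto simp: affine_plane_def pencil_def)

lemma pencil_subset: "pencil x \<subseteq> \<B>"
  by (auto simp: pencil_def)

lemma finite_pencil: "finite (pencil x)"
  using finite_blocks pencil_subset finite_subset by blast

lemma unique_join:
  "x \<in> X \<Longrightarrow> y \<in> X \<Longrightarrow> x \<noteq> y \<Longrightarrow> \<exists>!b. b \<in> \<B> \<and> x \<in> b \<and> y \<in> b"
  using plane by (simp add: affine_plane_def)

lemma joining_block: "x \<in> X \<Longrightarrow> y \<in> X \<Longrightarrow> x \<noteq> y \<Longrightarrow> \<exists>b\<in>\<B>. x \<in> b \<and> y \<in> b"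
  using ex1_implies_ex[OF unique_join[of x y]] by blast

lemma block_through_point:
  assumes "x \<in> X"
  shows "\<exists>b\<in>\<B>. x \<in> b"
proof -
  have "pencil x \<noteq> {}" using card_pencil[OF assms] by force
  then show ?thesis by (auto simp: pencil_def)
qed

lemma blocks_meet_once:
  assumes "b \<in> \<B>" "c \<in> \<B>" "b \<noteq> c" "x \<in> b" "x \<in> c" "y \<in> b" "y \<in> c"
  shows "x = y"
proof (rule ccontr)
  assume "x \<noteq> y"
  moreover have "x \<in> X" "y \<in> X" using assms block_subset by auto
  ultimately have "\<exists>!b. b \<in> \<B> \<and> x \<in> b \<and> y \<in> b"
    by (intro unique_join)
  then show False using assms by metis
qed

section \<open>Parallel classes and Playfair's axiom\<close>

lemma parallel_class_exists:
  assumes "b \<in> \<B>"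
  shows "\<exists>C. parallel_class C \<and> b \<in> C"
proof -
  obtain P where P: "partition_on \<B> P" "\<forall>C\<in>P. card C = k \<and> disjoint C \<and> \<Union>C = X"
    using plane unfolding affine_plane_def by (elim conjE exE)
  obtain C where "C \<in> P" "b \<in> C"
    using P(1) assms unfolding partition_on_def by blast
  moreover have "C \<subseteq> \<B>"
    using P(1) \<open>C \<in> P\<close> unfolding partition_on_def by blast
  ultimately show ?thesis
    using P(2) unfolding parallel_class_def by blast
qed

lemma finite_parallel_class: "parallel_class C \<Longrightarrow> finite C"
  using finite_blocks finite_subset unfolding parallel_class_def by blast

lemma parallel_class_eq:
  "parallel_class C \<Longrightarrow> b \<in> C \<Longrightarrow> c \<in> C \<Longrightarrow> x \<in> b \<Longrightarrow> x \<in> c \<Longrightarrow> b = c"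
  unfolding parallel_class_def disjoint_def by blast

text \<open>Every point of \<open>d\<close> lies on a block of \<open>C\<close>, and no block of
  \<open>C\<close> contains two points of \<open>d\<close>, as \<open>d\<close> is not one of them.
  So distinct points of \<open>d\<close> outside \<open>\<Union>M\<close> need distinct blocks of
  \<open>C - M\<close>.\<close>

lemma card_block_diff_classes:
  assumes C: "parallel_class C" and d: "d \<in> \<B>" "d \<notin> C"
  shows "card (d - \<Union>M) \<le> card (C - M)"
proof -
  have "\<forall>x\<in>d - \<Union>M. \<exists>c. c \<in> C - M \<and> x \<in> c"
    using C d block_subset unfolding parallel_class_def by blast
  then obtain f where f: "\<forall>x\<in>d - \<Union>M. f x \<in> C - M \<and> x \<in> f x" by metis
  have "inj_on f (d - \<Union>M)"
  proof (rule inj_onI)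
    fix x y assume "x \<in> d - \<Union>M" "y \<in> d - \<Union>M" "f x = f y"
    moreover have "f x \<noteq> d" "f x \<in> \<B>"
      using f calculation(1) C d unfolding parallel_class_def by auto
    ultimately show "x = y"
      using f d blocks_meet_once[of d "f x" x y] by (metis DiffD1)
  qed
  then show ?thesis
    by (rule card_inj_on_le) (use f finite_parallel_class[OF C] in auto)
qed

text \<open>If \<open>d\<close> missed \<open>c\<close>, its \<open>k\<close> points would have to
  lie on distinct blocks among the other \<open>k - 1\<close> blocks of the class.\<close>

lemma parallel_class_meets:
  assumes C: "parallel_class C" "c \<in> C" and d: "d \<in> \<B>" "d \<notin> C"
  shows "d \<inter> c \<noteq> {}"
proof
  assume "d \<inter> c = {}"
  then have "d - \<Union>{c} = d" by blast
  then have "k \<le> card (C - {c})"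
    using card_block_diff_classes[OF C(1) d, of "{c}"] card_block[OF d(1)] by simp
  then show False
    using C finite_parallel_class[OF C(1)] order_ge_2
    by (simp add: card_Diff_singleton parallel_class_def)
qed

lemma parallel_iff_class:
  assumes "parallel_class C" "c \<in> C" "d \<in> \<B>"
  shows "parallel d c \<longleftrightarrow> d \<in> C"
  using assms parallel_class_meets[OF assms(1,2,3)]
  unfolding parallel_def parallel_class_def disjoint_def by blast

lemma parallel_sym: "parallel b c \<longleftrightarrow> parallel c b"
  by (auto simp: parallel_def)

text \<open>Both blocks belong to the parallel class of \<open>c\<close>, whose members are pairwise
  disjoint, and both contain \<open>x\<close>.\<close>

lemma playfair_unique:
  assumes "c \<in> \<B>" "d \<in> pencil x" "e \<in> pencil x" "parallel d c" "parallel e c"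
  shows "d = e"
proof -
  obtain C where C: "parallel_class C" "c \<in> C"
    using parallel_class_exists assms(1) by blast
  have "d \<in> C" "e \<in> C"
    using parallel_iff_class[OF C] assms by (auto simp: pencil_def)
  then show ?thesis
    using parallel_class_eq[OF C(1)] assms by (auto simp: pencil_def)
qed

lemma playfair_exists:
  assumes "c \<in> \<B>" "x \<in> X"
  shows "\<exists>d\<in>pencil x. parallel d c"
proof -
  obtain C where C: "parallel_class C" "c \<in> C"
    using parallel_class_exists assms(1) by blast
  obtain d where "d \<in> C" "x \<in> d"
    using C(1) assms(2) unfolding parallel_class_def by blast
  then show ?thesis
    using parallel_iff_class[OF C] C(1) unfolding parallel_class_def pencil_def by blast
qed

text \<open>Each block of \<open>M\<close> has a parallel through \<open>p\<close>. Since distinct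
  blocks of one pencil have distinct parallels, \<open>card M\<close> of the \<open>k + 1\<close>
  blocks through \<open>p\<close> are ruled out.\<close>

lemma card_pencil_non_parallel:
  assumes "M \<subseteq> pencil q" "p \<in> X"
  shows "card {d \<in> pencil p. \<forall>c\<in>M. \<not> parallel d c} + card M \<le> k + 1"
proof -
  have MB: "M \<subseteq> \<B>" using assms(1) pencil_subset by blast
  obtain f where f: "\<And>c. c \<in> M \<Longrightarrow> f c \<in> pencil p \<and> parallel (f c) c"
    using playfair_exists[OF _ assms(2)] MB by (metis subsetD)
  have inj: "inj_on f M"
  proof (rule inj_onI)
    fix c c' assume c: "c \<in> M" "c' \<in> M" "f c = f c'"
    then have "parallel c (f c)" "parallel c' (f c)" "f c \<in> \<B>"
      using f pencil_subset parallel_sym by (auto, metis)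
    then show "c = c'" using playfair_unique[of "f c" c q c'] c assms(1) by blast
  qed
  let ?N = "{d \<in> pencil p. \<forall>c\<in>M. \<not> parallel d c}"
  have "?N \<inter> f ` M = {}" using f by blast
  moreover have "finite ?N" "finite (f ` M)"
    using finite_pencil MB finite_blocks finite_subset by (auto, blast)
  ultimately have "card ?N + card (f ` M) = card (?N \<union> f ` M)"
    by (simp add: card_Un_disjoint)
  also have "\<dots> \<le> card (pencil p)"
    using f by (intro card_mono finite_pencil) auto
  finally show ?thesis
    using card_image[OF inj] card_pencil[OF assms(2)] by simp
qed

section \<open>Distances in the incidence graph\<close>

lemma edge_iff:
  "(Inl x, Inr b) \<in> E \<longleftrightarrow> b \<in> \<B> \<and> x \<in> b"
  "(Inr b, Inl x) \<in> E \<longleftrightarrow> b \<in> \<B> \<and> x \<in> b"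
  "(Inl x, Inl y) \<notin> E"
  "(Inr b, Inr c) \<notin> E"
  using block_subset by (auto simp: incidence_edges_def)

text \<open>Every edge joins a point and a block. Lower bounds on distances then only require
  excluding the short lengths of the right parity.\<close>

lemma walk_parity: "(u, v) \<in> E ^^ n \<Longrightarrow> even n \<longleftrightarrow> isl u = isl v"
proof (induction n arbitrary: v)
  case (Suc n)
  then obtain w where w: "(u, w) \<in> E ^^ n" "(w, v) \<in> E" by auto
  then have "isl w \<noteq> isl v" by (auto simp: incidence_edges_def)
  then show ?case using Suc.IH[OF w(1)] by auto
qed simp

lemma dist_self [simp]: "graph_dist E u u = 0"
  unfolding graph_dist_def by (rule Least_equality) auto

lemma dist_point_point:
  assumes "x \<in> X" "y \<in> X" "x \<noteq> y"
  shows "graph_dist E (Inl x) (Inl y) = 2"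
  unfolding graph_dist_def
proof (rule Least_equality)
  obtain b where "b \<in> \<B>" "x \<in> b" "y \<in> b" using joining_block[OF assms] by blast
  then have "(Inl x, Inr b) \<in> E" "(Inr b, Inl y) \<in> E" using edge_iff by auto
  then show "(Inl x, Inl y) \<in> E ^^ 2"
    by (auto simp: numeral_2_eq_2 intro!: relcompI)
next
  fix n assume n: "(Inl x, Inl y) \<in> E ^^ n"
  then have "n \<noteq> 0" using assms by (intro notI) auto
  moreover have "even n" using walk_parity[OF n] by simp
  ultimately show "2 \<le> n" by presburger
qed

lemma dist_incident:
  assumes "b \<in> \<B>" "x \<in> b"
  shows "graph_dist E (Inl x) (Inr b) = 1" "graph_dist E (Inr b) (Inl x) = 1"
proof -
  show "graph_dist E (Inl x) (Inr b) = 1"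
    unfolding graph_dist_def
  proof (rule Least_equality)
    show "(Inl x, Inr b) \<in> E ^^ 1" using assms edge_iff by simp
    fix n assume "(Inl x, Inr b) \<in> E ^^ n"
    then show "1 \<le> n" using walk_parity by (cases n) auto
  qed
  show "graph_dist E (Inr b) (Inl x) = 1"
    unfolding graph_dist_def
  proof (rule Least_equality)
    show "(Inr b, Inl x) \<in> E ^^ 1" using assms edge_iff by simp
    fix n assume "(Inr b, Inl x) \<in> E ^^ n"
    then show "1 \<le> n" using walk_parity by (cases n) auto
  qed
qed

lemma dist_non_incident:
  assumes "b \<in> \<B>" "x \<in> X" "x \<notin> b"
  shows "graph_dist E (Inl x) (Inr b) = 3" "graph_dist E (Inr b) (Inl x) = 3"
proof -
  obtain y where y: "y \<in> b" using block_nonempty assms(1) by blast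
  then obtain c where c: "c \<in> \<B>" "x \<in> c" "y \<in> c"
    using joining_block[of x y] assms block_subset by blast
  have edges: "(Inl x, Inr c) \<in> E" "(Inr c, Inl y) \<in> E" "(Inl y, Inr b) \<in> E"
    "(Inr b, Inl y) \<in> E" "(Inl y, Inr c) \<in> E" "(Inr c, Inl x) \<in> E"
    using y c assms edge_iff by auto
  have ge: "3 \<le> n" if "odd n" "n \<noteq> 1" for n :: nat using that by presburger
  show "graph_dist E (Inl x) (Inr b) = 3"
    unfolding graph_dist_def
  proof (rule Least_equality)
    show "(Inl x, Inr b) \<in> E ^^ 3"
      using edges(1-3) by (auto simp: numeral_3_eq_3 intro!: relcompI)
    fix n assume n: "(Inl x, Inr b) \<in> E ^^ n"
    have "odd n" using walk_parity[OF n] by simp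
    moreover have "n \<noteq> 1" using n assms edge_iff by (intro notI) auto
    ultimately show "3 \<le> n" by (rule ge)
  qed
  show "graph_dist E (Inr b) (Inl x) = 3"
    unfolding graph_dist_def
  proof (rule Least_equality)
    show "(Inr b, Inl x) \<in> E ^^ 3"
      using edges(4-6) by (auto simp: numeral_3_eq_3 intro!: relcompI)
    fix n assume n: "(Inr b, Inl x) \<in> E ^^ n"
    have "odd n" using walk_parity[OF n] by simp
    moreover have "n \<noteq> 1" using n assms edge_iff by (intro notI) auto
    ultimately show "3 \<le> n" by (rule ge)
  qed
qed

lemma dist_meeting_blocks:
  assumes "b \<in> \<B>" "c \<in> \<B>" "\<not> parallel b c"
  shows "graph_dist E (Inr b) (Inr c) = 2"
  unfolding graph_dist_def
proof (rule Least_equality)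
  obtain x where "x \<in> b" "x \<in> c" using assms by (auto simp: parallel_def)
  then have "(Inr b, Inl x) \<in> E" "(Inl x, Inr c) \<in> E" using edge_iff assms by auto
  then show "(Inr b, Inr c) \<in> E ^^ 2"
    by (auto simp: numeral_2_eq_2 intro!: relcompI)
next
  fix n assume n: "(Inr b, Inr c) \<in> E ^^ n"
  then have "n \<noteq> 0" using assms by (intro notI) (auto simp: parallel_def)
  moreover have "even n" using walk_parity[OF n] by simp
  ultimately show "2 \<le> n" by presburger
qed

text \<open>A walk of length 4 uses the block joining a point of \<open>b\<close> to a point of
  \<open>c\<close>; a walk of length 2 would give a common point.\<close>

lemma dist_disjoint_blocks:
  assumes "b \<in> \<B>" "c \<in> \<B>" "b \<inter> c = {}"
  shows "graph_dist E (Inr b) (Inr c) = 4"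
  unfolding graph_dist_def
proof (rule Least_equality)
  obtain x y where xy: "x \<in> b" "y \<in> c" using block_nonempty assms by blast
  then obtain d where d: "d \<in> \<B>" "x \<in> d" "y \<in> d"
    using joining_block[of x y] assms block_subset by blast
  have "(Inr b, Inl x) \<in> E" "(Inl x, Inr d) \<in> E" "(Inr d, Inl y) \<in> E" "(Inl y, Inr c) \<in> E"
    using xy d assms edge_iff by auto
  then show "(Inr b, Inr c) \<in> E ^^ 4"
    by (auto simp: numeral_eq_Suc intro!: relcompI)
next
  fix n assume n: "(Inr b, Inr c) \<in> E ^^ n"
  have "n \<noteq> 0" using n assms block_nonempty by (intro notI) auto
  moreover have "n \<noteq> 2"
  proof
    assume "n = 2"
    then obtain w where "(Inr b, w) \<in> E" "(w, Inr c) \<in> E"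
      using n by (auto simp: numeral_eq_Suc)
    then show False using assms by (auto simp: incidence_edges_def)
  qed
  moreover have "even n" using walk_parity[OF n] by simp
  ultimately show "4 \<le> n" by presburger
qed

lemma dist_point_point_eq:
  "x \<in> X \<Longrightarrow> y \<in> X \<Longrightarrow> graph_dist E (Inl x) (Inl y) = (if x = y then 0 else 2)"
  using dist_point_point by simp

lemma dist_point_block_eq:
  "x \<in> X \<Longrightarrow> b \<in> \<B> \<Longrightarrow> graph_dist E (Inl x) (Inr b) = (if x \<in> b then 1 else 3)"
  using dist_incident dist_non_incident by simp

lemma dist_block_point_eq:
  "x \<in> X \<Longrightarrow> b \<in> \<B> \<Longrightarrow> graph_dist E (Inr b) (Inl x) = (if x \<in> b then 1 else 3)"
  using dist_incident dist_non_incident by simp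

lemma dist_block_block_eq:
  "b \<in> \<B> \<Longrightarrow> c \<in> \<B> \<Longrightarrow> graph_dist E (Inr b) (Inr c) =
    (if b = c then 0 else if parallel b c then 4 else 2)"
  using dist_meeting_blocks dist_disjoint_blocks parallel_def by auto

lemmas dist_eqs = dist_point_point_eq dist_point_block_eq dist_block_point_eq dist_block_block_eq

text \<open>A single probe tells whether the robber is on a point or on a block, by the parity of
  the distance.\<close>

lemma same_dist_isl:
  assumes "graph_dist E x u = graph_dist E x v" "x \<in> V" "u \<in> V" "v \<in> V"
  shows "isl u = isl v"
  using assms by (auto simp: dist_eqs split: if_splits)

section \<open>A strategy for \<open>k\<close> cops\<close>

text \<open>The \<open>n - 1\<close> probed points and \<open>k - n + 1\<close> probed blocks add up
  to \<open>k\<close>. The points separate the positions in \<open>A\<close> and otherwise reveal a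
  point on the robber's block; the blocks then leave at most \<open>k + 1 - (k - n + 1) = n\<close>
  candidates through that point.\<close>

lemma points_on_block_step:
  assumes A: "A \<subseteq> L" "L \<in> \<B>" "card A = n" "2 \<le> n"
    and pencils: "\<And>p F. p \<in> X \<Longrightarrow> F \<subseteq> pencil p \<Longrightarrow> card F \<le> n \<Longrightarrow>
      cops_win_after V E k (Inr ` F)"
  shows "cops_win_after V E k (Inl ` A)"
proof -
  have AX: "A \<subseteq> X" using A block_subset by blast
  have finA: "finite A" using A(1) finite_block[OF A(2)] by (rule finite_subset)
  have nk: "n \<le> k"
    using card_mono[OF finite_block[OF A(2)] A(1)] A(3) card_block[OF A(2)] by simp
  obtain p where p: "p \<in> A" using A(3,4) by fastforce
  have "k - n + 1 \<le> card (pencil p)" using card_pencil p AX by auto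
  then obtain M where M: "M \<subseteq> pencil p" "card M = k - n + 1"
    by (meson obtain_subset_with_card_n)
  have MB: "M \<subseteq> \<B>" "finite M" using M pencil_subset finite_pencil finite_subset by blast+
  define P where "P = Inl ` (A - {p}) \<union> Inr ` M"
  have PV: "P \<subseteq> V" using AX MB by (auto simp: P_def)
  have Pne: "P \<noteq> {}" using M(2) by (auto simp: P_def)
  have "card P \<le> card (A - {p}) + card M"
    unfolding P_def by (rule order_trans[OF card_Un_le]) (intro add_mono card_image_le; simp add: finA MB)
  then have cardP: "card P \<le> k"
    using p finA A(3,4) nk M(2) by (simp add: card_Diff_singleton)
  let ?S = "closed_nbhd E (Inl ` A)"
  have S: "?S \<subseteq> Inl ` A \<union> Inr ` {d \<in> \<B>. d \<inter> A \<noteq> {}}"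
    by (auto simp: closed_nbhd_def incidence_edges_def)
  have SV: "?S \<subseteq> V" using S AX by auto
  have "cops_win_from V E k ?S"
  proof (rule cops_win_from_probe_set[OF _ cardP Pne PV])
    show "finite P" using finA MB by (simp add: P_def)
    fix v assume v: "v \<in> ?S"
    show "\<exists>T. cops_win_after V E k T \<and>
      (\<forall>u\<in>?S. (\<forall>x\<in>P. graph_dist E x u = graph_dist E x v) \<longrightarrow> u \<in> T)"
    proof (cases v)
      case (Inl x)
      have xA: "x \<in> A" using v S Inl by auto
      have "u = v" if u: "u \<in> ?S" "\<forall>x\<in>P. graph_dist E x u = graph_dist E x v" for u
      proof -
        have "isl u = isl v" using same_dist_isl Pne u v SV PV by (metis all_not_in_conv subsetD)
        then obtain y where y: "u = Inl y" "y \<in> A" using Inl u S by (cases u) auto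
        show ?thesis
        proof (rule ccontr)
          assume "u \<noteq> v"
          then have "x \<noteq> y" using y Inl by simp
          then have "Inl x \<in> P \<or> Inl y \<in> P" using xA y by (auto simp: P_def)
          then show False using u(2) y Inl xA AX \<open>x \<noteq> y\<close> by (auto simp: dist_eqs subset_iff)
        qed
      qed
      then show ?thesis by (intro exI[of _ "{v}"]) (auto simp: cops_win_after_def)
    next
      case (Inr d)
      have d: "d \<in> \<B>" "d \<inter> A \<noteq> {}" using v S Inr by auto
      have same: "\<exists>e. u = Inr e \<and> e \<in> \<B> \<and> e \<inter> A \<noteq> {} \<and>
          (\<forall>x\<in>A - {p}. x \<in> e \<longleftrightarrow> x \<in> d) \<and> (\<forall>c\<in>M. parallel e c \<longleftrightarrow> parallel d c)"
        if u: "u \<in> ?S" "\<forall>x\<in>P. graph_dist E x u = graph_dist E x v" for u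
      proof -
        have "isl u = isl v" using same_dist_isl Pne u v SV PV by (metis all_not_in_conv subsetD)
        then obtain e where e: "u = Inr e" "e \<in> \<B>" "e \<inter> A \<noteq> {}" using Inr u S by (cases u) auto
        have "x \<in> e \<longleftrightarrow> x \<in> d" if "x \<in> A - {p}" for x
        proof -
          have "graph_dist E (Inl x) (Inr e) = graph_dist E (Inl x) (Inr d)"
            using u(2) that e Inr by (auto simp: P_def)
          then show ?thesis using that AX e d by (auto simp: dist_eqs subset_iff split: if_splits)
        qed
        moreover have "parallel e c \<longleftrightarrow> parallel d c" if "c \<in> M" for c
        proof -
          have "graph_dist E (Inr c) (Inr e) = graph_dist E (Inr c) (Inr d)"
            using u(2) that e Inr by (auto simp: P_def)
          then show ?thesis using that MB e d parallel_sym[of _ c]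
            by (auto simp: dist_eqs subset_iff parallel_def split: if_splits)
        qed
        ultimately show ?thesis using e by blast
      qed
      \<comment> \<open>The answers reveal a point of \<open>A\<close> on the robber's block: a
        probed one at distance 1 if there is any, otherwise \<open>p\<close>, since the block meets
        \<open>A\<close>.\<close>
      obtain q where q: "q \<in> A" "\<forall>u\<in>?S. (\<forall>x\<in>P. graph_dist E x u = graph_dist E x v) \<longrightarrow>
          u \<in> Inr ` pencil q" "d \<in> pencil q"
      proof (cases "d \<inter> (A - {p}) = {}")
        case True
        then have "p \<in> d" using d by blast
        moreover have "u \<in> Inr ` pencil p"
          if "u \<in> ?S" "\<forall>x\<in>P. graph_dist E x u = graph_dist E x v" for u
          using same[OF that] True unfolding pencil_def by blast
        ultimately show ?thesis using that[of p] p d by (auto simp: pencil_def)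
      next
        case False
        then obtain q where q: "q \<in> A - {p}" "q \<in> d" by blast
        have "u \<in> Inr ` pencil q"
          if "u \<in> ?S" "\<forall>x\<in>P. graph_dist E x u = graph_dist E x v" for u
          using same[OF that] q unfolding pencil_def by blast
        then show ?thesis using that[of q] q d by (auto simp: pencil_def)
      qed
      show ?thesis
      proof (cases "\<exists>c\<in>M. parallel d c")
        case True
        then obtain c where c: "c \<in> M" "parallel d c" by blast
        \<comment> \<open>Only one block through \<open>q\<close> is parallel to \<open>c\<close>,
          so this answer locates the robber.\<close>
        have "u = v" if u: "u \<in> ?S" "\<forall>x\<in>P. graph_dist E x u = graph_dist E x v" for u
        proof -
          obtain e where e: "u = Inr e" "parallel e c" using same[OF u] c by blast
          have "e \<in> pencil q" using q(2) u e by blast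
          then have "e = d" using playfair_unique[of c e q d] e c MB q(3) by blast
          then show ?thesis using e Inr by simp
        qed
        then show ?thesis by (intro exI[of _ "{v}"]) (auto simp: cops_win_after_def)
      next
        case False
        let ?F = "{e \<in> pencil q. \<forall>c\<in>M. \<not> parallel e c}"
        have "card ?F \<le> n"
          using card_pencil_non_parallel[OF M(1), of q] q(1) AX M(2) nk by auto
        then have "cops_win_after V E k (Inr ` ?F)"
          using pencils[of q ?F] q(1) AX by blast
        moreover have "u \<in> Inr ` ?F"
          if u: "u \<in> ?S" "\<forall>x\<in>P. graph_dist E x u = graph_dist E x v" for u
        proof -
          obtain e where "u = Inr e" "\<forall>c\<in>M. parallel e c \<longleftrightarrow> parallel d c"
            using same[OF u] by blast
          then show ?thesis using q(2) u False by blast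
        qed
        ultimately show ?thesis by blast
      qed
    qed
  qed
  then show ?thesis by (simp add: cops_win_after_def)
qed

text \<open>Of the \<open>n + 1\<close> blocks of \<open>F\<close> all but \<open>l\<close> are
  probed, so a robber on a point is known to be on a certain block \<open>b\<close>. A probed class
  block through his point meets \<open>b\<close> only there; otherwise he is on one of the
  \<open>n\<close> unprobed class blocks, each of which meets \<open>b\<close> at most once.\<close>

lemma blocks_through_point_step:
  assumes F: "F \<subseteq> pencil p" "p \<in> X" "card F = Suc n" "1 \<le> n" "Suc n \<le> k"
    and points: "\<And>L A. L \<in> \<B> \<Longrightarrow> A \<subseteq> L \<Longrightarrow> card A \<le> n \<Longrightarrow> cops_win_after V E k (Inl ` A)"
  shows "cops_win_after V E k (Inr ` F)"
proof -
  have FB: "F \<subseteq> \<B>" "finite F" using F pencil_subset finite_pencil finite_subset by blast+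
  obtain l where l: "l \<in> F" using F(3) by fastforce
  \<comment> \<open>\<open>F\<close> has at most \<open>k\<close> of the \<open>k + 1\<close> blocks
    through \<open>p\<close>, so a block \<open>m\<close> is left over. The class of
    \<open>m\<close> has no other block through \<open>p\<close> and thus avoids
    \<open>F\<close>.\<close>
  have "F \<noteq> pencil p" using card_pencil[OF F(2)] F(3,5) by auto
  then obtain m where m: "m \<in> pencil p" "m \<notin> F" using F(1) by blast
  obtain C where C: "parallel_class C" "m \<in> C"
    using parallel_class_exists m pencil_subset by blast
  have CB: "C \<subseteq> \<B>" "card C = k" "finite C"
    using C finite_parallel_class by (auto simp: parallel_class_def)
  have FC: "F \<inter> C = {}"
    using parallel_class_eq[OF C(1) _ C(2)] m F(1) unfolding pencil_def by blast
  have "k - n \<le> card C" using CB by simp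
  then obtain M where M: "M \<subseteq> C" "card M = k - n" "finite M"
    by (meson obtain_subset_with_card_n)
  define P where "P = (Inr ` (F - {l} \<union> M) :: ('a + 'a set) set)"
  have PV: "P \<subseteq> V" using FB CB M by (auto simp: P_def)
  have Pne: "P \<noteq> {}" using M(2) F(5) by (auto simp: P_def)
  have "card P \<le> card (F - {l} \<union> M)"
    unfolding P_def using FB M by (intro card_image_le) auto
  also have "\<dots> \<le> card (F - {l}) + card M" by (rule card_Un_le)
  finally have cardP: "card P \<le> k"
    using l FB F M by (simp add: card_Diff_singleton)
  let ?S = "closed_nbhd E (Inr ` F)"
  have S: "?S \<subseteq> Inr ` F \<union> Inl ` \<Union>F"
    by (auto simp: closed_nbhd_def incidence_edges_def)
  have UF: "\<Union>F \<subseteq> X" using FB block_subset by blast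
  have SV: "?S \<subseteq> V" using S FB UF by auto
  have "cops_win_from V E k ?S"
  proof (rule cops_win_from_probe_set[OF _ cardP Pne PV])
    show "finite P" using FB M by (simp add: P_def)
    fix v assume v: "v \<in> ?S"
    show "\<exists>T. cops_win_after V E k T \<and>
      (\<forall>u\<in>?S. (\<forall>x\<in>P. graph_dist E x u = graph_dist E x v) \<longrightarrow> u \<in> T)"
    proof (cases v)
      case (Inr d)
      have dF: "d \<in> F" using v S Inr by auto
      have "u = v" if u: "u \<in> ?S" "\<forall>x\<in>P. graph_dist E x u = graph_dist E x v" for u
      proof -
        have "isl u = isl v" using same_dist_isl Pne u v SV PV by (metis all_not_in_conv subsetD)
        then obtain e where e: "u = Inr e" "e \<in> F" using Inr u S by (cases u) auto
        show ?thesis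
        proof (rule ccontr)
          assume "u \<noteq> v"
          then have "d \<noteq> e" using e Inr by simp
          then have "Inr d \<in> P \<or> Inr e \<in> P" using dF e by (auto simp: P_def)
          then show False using u(2) e Inr dF FB \<open>d \<noteq> e\<close>
            by (auto simp: dist_eqs subset_iff split: if_splits)
        qed
      qed
      then show ?thesis by (intro exI[of _ "{v}"]) (auto simp: cops_win_after_def)
    next
      case (Inl x)
      have x: "x \<in> \<Union>F" "x \<in> X" using v S Inl UF by auto
      have same: "\<exists>y. u = Inl y \<and> y \<in> \<Union>F \<and> (\<forall>d\<in>F - {l} \<union> M. y \<in> d \<longleftrightarrow> x \<in> d)"
        if u: "u \<in> ?S" "\<forall>x\<in>P. graph_dist E x u = graph_dist E x v" for u
      proof -
        have "isl u = isl v" using same_dist_isl Pne u v SV PV by (metis all_not_in_conv subsetD)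
        then obtain y where y: "u = Inl y" "y \<in> \<Union>F" using Inl u S by (cases u) auto
        have yX: "y \<in> X" using y(2) UF by blast
        have "y \<in> d \<longleftrightarrow> x \<in> d" if "d \<in> F - {l} \<union> M" for d
        proof -
          have "d \<in> \<B>" using that FB CB M by auto
          moreover have "graph_dist E (Inr d) (Inl y) = graph_dist E (Inr d) (Inl x)"
            using u(2) that y Inl by (auto simp: P_def)
          ultimately show ?thesis using x yX by (simp add: dist_eqs split: if_splits)
        qed
        then show ?thesis using y by blast
      qed
      obtain b where b: "b \<in> F" "x \<in> b" "\<forall>u\<in>?S. (\<forall>x\<in>P. graph_dist E x u = graph_dist E x v) \<longrightarrow>
          u \<in> Inl ` b"
      proof (cases "\<exists>b\<in>F - {l}. x \<in> b")
        case True
        then obtain b where b: "b \<in> F - {l}" "x \<in> b" by blast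
        have "u \<in> Inl ` b"
          if "u \<in> ?S" "\<forall>x\<in>P. graph_dist E x u = graph_dist E x v" for u
          using same[OF that] b by blast
        then show ?thesis using that[of b] b by blast
      next
        case False
        then have "x \<in> l" using x by blast
        moreover have "u \<in> Inl ` l"
          if "u \<in> ?S" "\<forall>x\<in>P. graph_dist E x u = graph_dist E x v" for u
          using same[OF that] False by blast
        ultimately show ?thesis using that[of l] l by blast
      qed
      have bB: "b \<in> \<B>" "b \<notin> C" using b FB FC by auto
      show ?thesis
      proof (cases "x \<in> \<Union>M")
        case True
        then obtain c where c: "c \<in> M" "x \<in> c" by blast
        have cb: "c \<in> \<B>" "c \<noteq> b" using c M CB bB by auto
        have "u = v" if u: "u \<in> ?S" "\<forall>x\<in>P. graph_dist E x u = graph_dist E x v" for u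
        proof -
          obtain y where y: "u = Inl y" "y \<in> c" using same[OF u] c by blast
          moreover have "y \<in> b" using b(3) u y by blast
          ultimately show ?thesis
            using blocks_meet_once[OF cb(1) bB(1) cb(2), of x y] b c Inl by simp
        qed
        then show ?thesis by (intro exI[of _ "{v}"]) (auto simp: cops_win_after_def)
      next
        case False
        have "card (C - M) = n" using CB M F(5) by (simp add: card_Diff_subset)
        then have "card (b - \<Union>M) \<le> n"
          using card_block_diff_classes[OF C(1) bB, of M] by simp
        then have "cops_win_after V E k (Inl ` (b - \<Union>M))"
          using points[OF bB(1)] by blast
        moreover have "u \<in> Inl ` (b - \<Union>M)"
          if u: "u \<in> ?S" "\<forall>x\<in>P. graph_dist E x u = graph_dist E x v" for u
        proof -
          obtain y where "u = Inl y" "\<forall>d\<in>M. y \<in> d \<longleftrightarrow> x \<in> d" using same[OF u] by blast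
          then show ?thesis using b(3) u False by blast
        qed
        ultimately show ?thesis by blast
      qed
    qed
  qed
  then show ?thesis by (simp add: cops_win_after_def)
qed

text \<open>The two claims alternate: \<open>Suc n\<close> blocks through a point reduce to
  \<open>n\<close> points on a block, and \<open>Suc n\<close> points on a block reduce to
  \<open>Suc n\<close> blocks through a point. At size one the robber is located.\<close>

lemma cops_win_after_points_and_pencils:
  assumes "n \<le> k"
  shows "(\<forall>L\<in>\<B>. \<forall>A\<subseteq>L. card A \<le> n \<longrightarrow> cops_win_after V E k (Inl ` A)) \<and>
    (\<forall>p\<in>X. \<forall>F\<subseteq>pencil p. card F \<le> n \<longrightarrow> cops_win_after V E k (Inr ` F))"
  using assms
proof (induction n)
  case 0
  have "A = {}" if "A \<subseteq> L" "L \<in> \<B>" "card A \<le> 0" for A L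
    using that finite_block finite_subset card_0_eq by (metis le_zero_eq)
  moreover have "F = {}" if "F \<subseteq> pencil p" "card F \<le> 0" for F p
    using that finite_pencil finite_subset card_0_eq by (metis le_zero_eq)
  ultimately show ?case by (auto simp: cops_win_after_def)
next
  case (Suc n)
  have IH: "\<And>L A. L \<in> \<B> \<Longrightarrow> A \<subseteq> L \<Longrightarrow> card A \<le> n \<Longrightarrow> cops_win_after V E k (Inl ` A)"
    "\<And>p F. p \<in> X \<Longrightarrow> F \<subseteq> pencil p \<Longrightarrow> card F \<le> n \<Longrightarrow> cops_win_after V E k (Inr ` F)"
    using Suc by auto
  have small: "\<forall>x\<in>A. \<forall>y\<in>A. x = y" if "finite A" "card A \<le> Suc 0" for A :: "'c set"
    using card_le_Suc0_iff_eq[OF that(1)] that(2) by simp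
  have pencils: "cops_win_after V E k (Inr ` F)"
    if F: "p \<in> X" "F \<subseteq> pencil p" "card F \<le> Suc n" for p F
  proof -
    consider "card F \<le> n" | "n = 0" | "card F = Suc n" "1 \<le> n" using F(3) by linarith
    then show ?thesis
    proof cases
      case 1
      then show ?thesis using IH(2) F by blast
    next
      case 2
      have "finite F" using F(2) finite_pencil finite_subset by blast
      then show ?thesis using small[of F] 2 F(3) by (auto simp: cops_win_after_def)
    next
      case 3
      show ?thesis by (rule blocks_through_point_step[OF F(2,1) 3 Suc.prems IH(1)])
    qed
  qed
  have "cops_win_after V E k (Inl ` A)" if A: "L \<in> \<B>" "A \<subseteq> L" "card A \<le> Suc n" for L A
  proof -
    consider "card A \<le> n" | "n = 0" | "card A = Suc n" "2 \<le> Suc n" using A(3) by linarith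
    then show ?thesis
    proof cases
      case 1
      then show ?thesis using IH(1) A by blast
    next
      case 2
      have "finite A" using A finite_block finite_subset by blast
      then show ?thesis using small[of A] 2 A(3) by (auto simp: cops_win_after_def)
    next
      case 3
      show ?thesis by (rule points_on_block_step[OF A(2,1) 3 pencils])
    qed
  qed
  with pencils show ?case by (intro conjI ballI allI impI)
qed

text \<open>
  Probing all but one block of a parallel class confines a robber on a point to a single block
  of that class. A robber who avoids this has to stay on the same block forever, so
  that he is caught by one further probe running through the points.
\<close>

lemma cops_win_from_points_and_blocks:
  assumes "F \<subseteq> \<B>"
  shows "cops_win_from V E k (Inl ` X \<union> Inr ` F)"
  using finite_subset[OF assms finite_blocks] assms
proof (induction F rule: finite_psubset_induct)
  case (psubset F)
  \<comment> \<open>If there are candidate blocks, \<open>q\<close> lies on one of them, so that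
    learning that \<open>q\<close> is not on the robber's block removes at least one
    candidate.\<close>
  obtain q where q: "q \<in> X" "F = {} \<or> (\<exists>b\<in>F. q \<in> b)"
  proof (cases "F = {}")
    case True
    then show ?thesis using that points_nonempty by blast
  next
    case False
    then obtain b where b: "b \<in> F" by blast
    then obtain q where "q \<in> b" using block_nonempty psubset.prems by blast
    then show ?thesis using that b block_subset psubset.prems by blast
  qed
  obtain c0 where "c0 \<in> \<B>" using block_through_point[OF q(1)] by blast
  then obtain C where C: "parallel_class C" "c0 \<in> C" using parallel_class_exists by blast
  have CB: "C \<subseteq> \<B>" "card C = k" "finite C" "\<Union>C = X"
    using C finite_parallel_class by (auto simp: parallel_class_def)
  define P where "P = insert (Inl q) (Inr ` (C - {c0}))"
  have PV: "P \<subseteq> V" using q CB by (auto simp: P_def)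
  have Pne: "P \<noteq> {}" by (auto simp: P_def)
  have "card P \<le> Suc (card (C - {c0}))"
    unfolding P_def using CB(3) by (intro card_insert_le_m1) (auto intro: card_image_le)
  then have cardP: "card P \<le> k" using CB C order_ge_2 by (simp add: card_Diff_singleton)
  have "card (C - {c0}) \<noteq> 0" using CB C order_ge_2 by (simp add: card_Diff_singleton)
  \<comment> \<open>\<open>c1\<close> is a probed block of the class; whether the robber's block is
    parallel to it decides whether that block belongs to \<open>C\<close>.\<close>
  then obtain c1 where c1: "c1 \<in> C" "c1 \<noteq> c0" by (metis Diff_iff all_not_in_conv card.empty singletonI)
  let ?S = "Inl ` X \<union> Inr ` F"
  have SV: "?S \<subseteq> V" using psubset.prems by auto
  show ?case
  proof (rule cops_win_from_probe_set[OF _ cardP Pne PV])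
    show "finite P" using CB(3) by (simp add: P_def)
    fix v assume v: "v \<in> ?S"
    show "\<exists>T. cops_win_after V E k T \<and>
      (\<forall>u\<in>?S. (\<forall>x\<in>P. graph_dist E x u = graph_dist E x v) \<longrightarrow> u \<in> T)"
    proof (cases v)
      case (Inl x)
      have xX: "x \<in> X" using v Inl by auto
      have same: "\<exists>y. u = Inl y \<and> y \<in> X \<and> (\<forall>c\<in>C - {c0}. y \<in> c \<longleftrightarrow> x \<in> c)"
        if u: "u \<in> ?S" "\<forall>x\<in>P. graph_dist E x u = graph_dist E x v" for u
      proof -
        have "isl u = isl v" using same_dist_isl Pne u v SV PV by (metis all_not_in_conv subsetD)
        then obtain y where y: "u = Inl y" "y \<in> X" using Inl u by (cases u) auto
        have "y \<in> c \<longleftrightarrow> x \<in> c" if "c \<in> C - {c0}" for c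
        proof -
          have "c \<in> \<B>" using that CB by auto
          moreover have "graph_dist E (Inr c) (Inl y) = graph_dist E (Inr c) (Inl x)"
            using u(2) that y Inl by (auto simp: P_def)
          ultimately show ?thesis using xX y by (simp add: dist_eqs split: if_splits)
        qed
        then show ?thesis using y by blast
      qed
      obtain c where c: "c \<in> C" "x \<in> c" using xX CB(4) by blast
      have "u \<in> Inl ` c" if u: "u \<in> ?S" "\<forall>x\<in>P. graph_dist E x u = graph_dist E x v" for u
      proof -
        obtain y where y: "u = Inl y" "y \<in> X" "\<forall>c\<in>C - {c0}. y \<in> c \<longleftrightarrow> x \<in> c"
          using same[OF u] by blast
        obtain c' where c': "c' \<in> C" "y \<in> c'" using y(2) CB(4) by blast
        \<comment> \<open>The unprobed block \<open>c0\<close> consists of the points on no probed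
          block of the class, so the answers identify the class block in every case.\<close>
        have "c' = c"
        proof (cases "c' = c0")
          case True
          have "c = c'" if "c \<noteq> c0"
            using that y(3) c c' parallel_class_eq[OF C(1) c(1) c'(1), of y] by blast
          then show ?thesis using True by blast
        next
          case False
          then have "x \<in> c'" using y(3) c' by blast
          then show ?thesis using c(2) parallel_class_eq[OF C(1) c'(1) c(1), of x] by blast
        qed
        then show ?thesis using y(1) c'(2) by blast
      qed
      moreover have "cops_win_after V E k (Inl ` c)"
        using cops_win_after_points_and_pencils[OF order_refl, THEN conjunct1, rule_format, of c c]
          c CB(1) card_block[of c] by auto
      ultimately show ?thesis by blast
    next
      case (Inr d)
      have d: "d \<in> F" "d \<in> \<B>" using v Inr psubset.prems by auto
      have same: "\<exists>e. u = Inr e \<and> e \<in> F \<and> e \<in> \<B> \<and> (q \<in> e \<longleftrightarrow> q \<in> d) \<and>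
          (\<forall>c\<in>C - {c0}. (e = c \<longleftrightarrow> d = c) \<and> (parallel e c \<longleftrightarrow> parallel d c))"
        if u: "u \<in> ?S" "\<forall>x\<in>P. graph_dist E x u = graph_dist E x v" for u
      proof -
        have "isl u = isl v" using same_dist_isl Pne u v SV PV by (metis all_not_in_conv subsetD)
        then obtain e where e: "u = Inr e" "e \<in> F" "e \<in> \<B>"
          using Inr u psubset.prems by (cases u) auto
        have "graph_dist E (Inl q) (Inr e) = graph_dist E (Inl q) (Inr d)"
          using u(2) e Inr by (auto simp: P_def)
        then have "q \<in> e \<longleftrightarrow> q \<in> d" using e d q by (simp add: dist_eqs split: if_splits)
        moreover have "(e = c \<longleftrightarrow> d = c) \<and> (parallel e c \<longleftrightarrow> parallel d c)" if "c \<in> C - {c0}" for c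
        proof -
          have "c \<in> \<B>" using that CB by auto
          moreover have "graph_dist E (Inr c) (Inr e) = graph_dist E (Inr c) (Inr d)"
            using u(2) that e Inr by (auto simp: P_def)
          ultimately show ?thesis using e d parallel_sym[of _ c]
            by (auto simp: dist_eqs parallel_def split: if_splits)
        qed
        ultimately show ?thesis using e by blast
      qed
      have class_same: "e \<in> C \<longleftrightarrow> d \<in> C" if "e \<in> \<B>" "parallel e c1 \<longleftrightarrow> parallel d c1" for e
        using that parallel_iff_class[OF C(1) c1(1)] d by blast
      show ?thesis
      proof (cases "d \<in> C")
        case True
        have "u = v" if u: "u \<in> ?S" "\<forall>x\<in>P. graph_dist E x u = graph_dist E x v" for u
        proof -
          obtain e where e: "u = Inr e" "e \<in> \<B>"
            "\<forall>c\<in>C - {c0}. (e = c \<longleftrightarrow> d = c) \<and> (parallel e c \<longleftrightarrow> parallel d c)"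
            using same[OF u] by blast
          have "e \<in> C" using class_same[OF e(2)] e(3) c1 True by blast
          then have "e = d" using e(3) True by blast
          then show ?thesis using e Inr by simp
        qed
        then show ?thesis by (intro exI[of _ "{v}"]) (auto simp: cops_win_after_def)
      next
        case dC: False
        show ?thesis
        proof (cases "q \<in> d")
          case True
          obtain c where c: "c \<in> C" "q \<in> c" using q(1) CB(4) by blast
          \<comment> \<open>As the robber's block is not in \<open>C\<close>, only \<open>k\<close>
            of the \<open>k + 1\<close> blocks through \<open>q\<close> remain, few enough for the
            strategy on pencils.\<close>
          have "card (pencil q - {c}) = k"
            using c CB card_pencil[OF q(1)] finite_pencil
            by (subst card_Diff_singleton) (auto simp: pencil_def)
          then have "cops_win_after V E k (Inr ` (pencil q - {c}))"
            using cops_win_after_points_and_pencils[OF order_refl, THEN conjunct2, rule_format,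
                of q "pencil q - {c}"] q(1) by auto
          moreover have "u \<in> Inr ` (pencil q - {c})"
            if u: "u \<in> ?S" "\<forall>x\<in>P. graph_dist E x u = graph_dist E x v" for u
          proof -
            obtain e where e: "u = Inr e" "e \<in> \<B>" "q \<in> e"
              "\<forall>c\<in>C - {c0}. (e = c \<longleftrightarrow> d = c) \<and> (parallel e c \<longleftrightarrow> parallel d c)"
              using same[OF u] True by blast
            have "e \<notin> C" using class_same[OF e(2)] e(4) c1 dC by blast
            then show ?thesis using e c by (auto simp: pencil_def)
          qed
          ultimately show ?thesis by blast
        next
          case False
          let ?F = "{e \<in> F. q \<notin> e}"
          have "?F \<subset> F" using q(2) d by blast
          then have "cops_win_from V E k (Inl ` X \<union> Inr ` ?F)"
            using psubset.IH[of ?F] psubset.prems by blast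
          \<comment> \<open>From a block the robber can only stay or go to a point, so the set of
            candidate blocks does not grow again.\<close>
          moreover have "closed_nbhd E (Inr ` ?F) \<subseteq> Inl ` X \<union> Inr ` ?F"
            by (auto simp: closed_nbhd_def incidence_edges_def)
          ultimately have "cops_win_after V E k (Inr ` ?F)"
            unfolding cops_win_after_def using cops_win_from_antimono by blast
          moreover have "u \<in> Inr ` ?F"
            if u: "u \<in> ?S" "\<forall>x\<in>P. graph_dist E x u = graph_dist E x v" for u
            using same[OF u] False by blast
          ultimately show ?thesis by blast
        qed
      qed
    qed
  qed
qed

lemma order_many_cops_win: "cops_win V E k"
  using cops_win_from_points_and_blocks[OF subset_refl]
  by (intro cops_win_if_from) (simp add: Plus_def)

section \<open>Evading fewer than \<open>k\<close> cops\<close>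

text \<open>Usually a point probe \<open>x\<close> answers 3, or 1 if \<open>x = p\<close>, and a
  block probe answers 2. The only exceptions among the blocks through \<open>p\<close> are the join
  of \<open>x\<close> and \<open>p\<close>, and the parallel of the probed block.\<close>

lemma blocks_unseparated:
  assumes "p \<in> X" "finite P" "card P < k" "P \<subseteq> V"
  shows "\<exists>b\<in>pencil p. \<exists>b'\<in>pencil p. b \<noteq> b' \<and>
    (\<forall>c\<in>P. graph_dist E c (Inr b) = graph_dist E c (Inr b'))"
proof (rule unseparated_pair[OF assms(2)])
  show "card P + 2 \<le> card (pencil p)" using assms card_pencil by simp
next
  fix c b b'
  assume c: "c \<in> P" and b: "b \<in> pencil p" "b' \<in> pencil p"
    and ne: "graph_dist E c (Inr b) \<noteq> (case c of Inl x \<Rightarrow> if x = p then 1 else 3 | Inr _ \<Rightarrow> 2)"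
      "graph_dist E c (Inr b') \<noteq> (case c of Inl x \<Rightarrow> if x = p then 1 else 3 | Inr _ \<Rightarrow> 2)"
  have bB: "b \<in> \<B>" "b' \<in> \<B>" "p \<in> b" "p \<in> b'" using b by (auto simp: pencil_def)
  show "b = b'"
  proof (cases c)
    case (Inl x)
    then have "x \<in> X" using c assms(4) by auto
    then have "x \<noteq> p" "x \<in> b" "x \<in> b'"
      using ne Inl bB by (auto simp: dist_eqs split: if_splits)
    then show ?thesis using blocks_meet_once[OF bB(1,2), of x p] bB by blast
  next
    case (Inr d)
    then have d: "d \<in> \<B>" using c assms(4) by auto
    then have "parallel b d" "parallel b' d"
      using ne Inr bB by (auto simp: dist_eqs parallel_def split: if_splits)
    then show ?thesis using playfair_unique[OF d b] by blast
  qed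
qed

text \<open>A probe has two possible distances to points, 0 or 2 from a point and 1 or 3 from a
  block; a hit is the smaller one.\<close>

definition hits :: "'a + 'a set \<Rightarrow> 'a \<Rightarrow> bool" where
  "hits c x \<longleftrightarrow> (case c of Inl y \<Rightarrow> x = y | Inr b \<Rightarrow> x \<in> b)"

lemma same_dist_if_same_hits:
  "c \<in> V \<Longrightarrow> x \<in> X \<Longrightarrow> y \<in> X \<Longrightarrow> hits c x \<longleftrightarrow> hits c y \<Longrightarrow>
    graph_dist E c (Inl x) = graph_dist E c (Inl y)"
  by (auto simp: hits_def dist_eqs)

lemma hits_block_once:
  assumes "c \<in> V" "b \<in> \<B>" "c \<noteq> Inr b" "x \<in> b" "y \<in> b" "hits c x" "hits c y"
  shows "x = y"
proof (cases c)
  case (Inr d)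
  then show ?thesis using assms blocks_meet_once[of b d x y] by (auto simp: hits_def)
qed (use assms in \<open>auto simp: hits_def\<close>)

text \<open>The probe of \<open>b\<close> answers alike on all points of \<open>b\<close>, and each
  of the at most \<open>k - 2\<close> other probes hits at most one of its \<open>k\<close>
  points.\<close>

lemma points_of_probed_block_unseparated:
  assumes "b \<in> \<B>" "finite P" "card P < k" "P \<subseteq> V" "Inr b \<in> P"
  shows "\<exists>x\<in>b. \<exists>y\<in>b. x \<noteq> y \<and> (\<forall>c\<in>P. graph_dist E c (Inl x) = graph_dist E c (Inl y))"
proof -
  let ?P = "P - {Inr b}"
  have bX: "b \<subseteq> X" by (rule block_subset[OF assms(1)])
  have "card P > 0" using assms(2,5) card_gt_0_iff by blast
  then have "card ?P + 2 \<le> card b"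
    using assms card_block by (simp add: card_Diff_singleton)
  then have "\<exists>x\<in>b. \<exists>y\<in>b. x \<noteq> y \<and> (\<forall>c\<in>?P. hits c x = hits c y)"
  proof (rule unseparated_pair[rotated])
    show "finite ?P" using assms(2) by simp
    fix c x y assume "c \<in> ?P" "x \<in> b" "y \<in> b" "hits c x \<noteq> False" "hits c y \<noteq> False"
    then show "x = y" using hits_block_once[of c b x y] assms(1,4) by blast
  qed
  then obtain x y where xy: "x \<in> b" "y \<in> b" "x \<noteq> y" "\<forall>c\<in>?P. hits c x = hits c y" by blast
  have "hits c x = hits c y" if "c \<in> P" for c
    using xy that by (cases "c = Inr b") (auto simp: hits_def)
  then have "\<forall>c\<in>P. graph_dist E c (Inl x) = graph_dist E c (Inl y)"
    using same_dist_if_same_hits xy(1,2) bX assms(4) by blast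
  then show ?thesis using xy by blast
qed

text \<open>Each of the \<open>k - 1\<close> points of \<open>b\<close> other than \<open>p\<close>
  is hit, no probe hits two points of \<open>b\<close>, and there are at most \<open>k - 1\<close>
  probes. So hitting is a bijection between these points and the probes.\<close>

lemma exclusively_hit_point:
  assumes "b \<in> \<B>" "p \<in> b" "finite P" "card P < k" "P \<subseteq> V" "Inr b \<notin> P"
    and all_hit: "\<And>x. x \<in> b - {p} \<Longrightarrow> \<exists>c\<in>P. hits c x" and "c \<in> P"
  shows "\<exists>x\<in>b - {p}. \<forall>c'\<in>P. hits c' x \<longleftrightarrow> c' = c"
proof -
  obtain f where f: "\<And>x. x \<in> b - {p} \<Longrightarrow> f x \<in> P \<and> hits (f x) x"
    using all_hit by metis
  have once: "x = y" if "d \<in> P" "x \<in> b" "y \<in> b" "hits d x" "hits d y" for d x y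
    using hits_block_once[of d b x y] that assms by blast
  have "inj_on f (b - {p})"
  proof (rule inj_onI)
    fix x y assume "x \<in> b - {p}" "y \<in> b - {p}" "f x = f y"
    then show "x = y" using f[of x] f[of y] once[of "f x" x y] by auto
  qed
  then have "card (f ` (b - {p})) = k - 1"
    using card_block[OF assms(1)] assms(2) finite_block[OF assms(1)]
    by (simp add: card_image card_Diff_singleton)
  moreover have "f ` (b - {p}) \<subseteq> P" using f by blast
  ultimately have onto: "f ` (b - {p}) = P"
    using assms(3,4) by (intro card_seteq) auto
  then obtain x where x: "x \<in> b - {p}" "f x = c" using assms(8) by blast
  have "c' = c" if "c' \<in> P" "hits c' x" for c'
  proof -
    have "c' \<in> f ` (b - {p})" using that(1) by (simp add: onto)
    then obtain z where z: "z \<in> b - {p}" "f z = c'" by (elim imageE) auto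
    then have "z = x" using once[of c' z x] f[OF z(1)] that x(1) by auto
    then show ?thesis using x z by simp
  qed
  then show ?thesis using x f[OF x(1)] by blast
qed

text \<open>
  If neither block is probed and every point other than \<open>p\<close> is hit, then by counting each probe
  hits one point of \<open>b\<close> and one of \<open>b'\<close>, and these two are hit by no other probe.
\<close>

lemma points_unseparated:
  assumes b: "b \<in> pencil p" "b' \<in> pencil p" "b \<noteq> b'"
    and P: "finite P" "card P < k" "P \<subseteq> V"
  shows "\<exists>x\<in>b \<union> b'. \<exists>y\<in>b \<union> b'. x \<noteq> y \<and>
    (\<forall>c\<in>P. graph_dist E c (Inl x) = graph_dist E c (Inl y))"
proof (cases "Inr b \<in> P \<or> Inr b' \<in> P")
  case True
  then show ?thesis
    using points_of_probed_block_unseparated[OF _ P] b unfolding pencil_def by blast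
next
  case False
  have bB: "b \<in> \<B>" "b' \<in> \<B>" "p \<in> b" "p \<in> b'" using b by (auto simp: pencil_def)
  have sub: "b \<union> b' \<subseteq> X" using bB block_subset by blast
  have "\<exists>x\<in>b \<union> b'. \<exists>y\<in>b \<union> b'. x \<noteq> y \<and> (\<forall>c\<in>P. hits c x = hits c y)"
  proof (rule ccontr)
    assume "\<not> ?thesis"
    then have sep: "x = y" if "x \<in> b \<union> b'" "y \<in> b \<union> b'" "\<And>c. c \<in> P \<Longrightarrow> hits c x = hits c y" for x y
      using that by blast
    \<comment> \<open>An unprobed block has more points than there are probes, and no probe hits two
      of them.\<close>
    have unhit: "\<exists>x\<in>d. \<forall>c\<in>P. \<not> hits c x" if d: "d \<in> \<B>" "Inr d \<notin> P" for d
    proof (rule ccontr)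
      assume "\<not> ?thesis"
      then obtain f where f: "\<And>x. x \<in> d \<Longrightarrow> f x \<in> P \<and> hits (f x) x" by metis
      have "inj_on f d"
      proof (rule inj_onI)
        fix x y assume "x \<in> d" "y \<in> d" "f x = f y"
        then show "x = y"
          using f[of x] f[of y] hits_block_once[of "f x" d x y] d P(3) by (metis subsetD)
      qed
      then have "card d \<le> card P" by (rule card_inj_on_le) (use f P in auto)
      then show False using card_block[OF d(1)] P(2) by simp
    qed
    obtain u where u: "u \<in> b" "\<forall>c\<in>P. \<not> hits c u" using unhit[OF bB(1)] False by blast
    obtain u' where u': "u' \<in> b'" "\<forall>c\<in>P. \<not> hits c u'" using unhit[OF bB(2)] False by blast
    \<comment> \<open>Unhit points look alike to all probes, so by \<open>sep\<close> there is only
      one in \<open>b \<union> b'\<close>, and it must be the common point \<open>p\<close>.\<close>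
    have "u = u'" using sep[of u u'] u u' by blast
    then have "u = p" using blocks_meet_once[OF bB(1,2) b(3), of u p] u u' bB by blast
    then have p: "\<forall>c\<in>P. \<not> hits c p" using u by blast
    have hit: "\<exists>c\<in>P. hits c x" if "x \<in> (b \<union> b') - {p}" for x
      using sep[of x p] p that bB by blast
    have "b - {p} \<noteq> {}"
    proof
      assume "b - {p} = {}"
      then have "b = {p}" using bB by blast
      then show False using card_block[OF bB(1)] order_ge_2 by simp
    qed
    then obtain c where c: "c \<in> P" using hit by blast
    obtain x where x: "x \<in> b - {p}" "\<forall>c'\<in>P. hits c' x \<longleftrightarrow> c' = c"
      using exclusively_hit_point[OF bB(1,3) P _ _ c] False hit by blast
    obtain y where y: "y \<in> b' - {p}" "\<forall>c'\<in>P. hits c' y \<longleftrightarrow> c' = c"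
      using exclusively_hit_point[OF bB(2,4) P _ _ c] False hit by blast
    have "x = y" using sep[of x y] x y by blast
    then show False using blocks_meet_once[OF bB(1,2) b(3), of x p] x y bB by blast
  qed
  then obtain x y where xy: "x \<in> b \<union> b'" "y \<in> b \<union> b'" "x \<noteq> y" "\<forall>c\<in>P. hits c x = hits c y"
    by blast
  have "\<forall>c\<in>P. graph_dist E c (Inl x) = graph_dist E c (Inl y)"
    using same_dist_if_same_hits xy sub P(3) by blast
  then show ?thesis using xy by blast
qed

text \<open>The strategy is deterministic, so an evading trajectory can be computed beforehand. For
  every round there has to be another trajectory with the same answers that is then at a different
  vertex; such decoys branch off from the main trajectory and are chosen anew every two
  rounds.\<close>

lemma few_cops_lose:
  assumes m: "m < k"
  shows "\<not> cops_win V E m"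
proof
  assume "cops_win V E m"
  then obtain \<sigma> where \<sigma>: "is_cop_strategy V m \<sigma>"
    and win: "\<And>r. robber_trajectory V E r \<Longrightarrow> \<exists>n. located V E \<sigma> r n"
    unfolding cops_win_def by blast
  define sig where "sig h v = map (\<lambda>c. graph_dist E c v) (\<sigma> h)" for h v
  have probes: "finite (set (\<sigma> h))" "card (set (\<sigma> h)) < k" "set (\<sigma> h) \<subseteq> V" for h
    using \<sigma> m card_length[of "\<sigma> h"] by (auto simp: is_cop_strategy_def)
  define good where "good h p t \<longleftrightarrow> (case t of (b, b', x, y) \<Rightarrow>
      b \<in> pencil p \<and> b' \<in> pencil p \<and> b \<noteq> b' \<and> x \<in> b \<and> y \<in> b \<union> b' \<and> x \<noteq> y \<and>
      sig h (Inr b) = sig h (Inr b') \<and>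
      sig (h @ [sig h (Inr b)]) (Inl x) = sig (h @ [sig h (Inr b)]) (Inl y))" for h p t
  \<comment> \<open>From \<open>p\<close>, after the answers \<open>h\<close>, the robber moves to \<open>b\<close> and then to \<open>x\<close>;
    the decoys \<open>b'\<close> and \<open>y\<close> produce the same answers.\<close>
  have ex: "\<exists>t. good h p t" if p: "p \<in> X" for h p
  proof -
    obtain b b' where b: "b \<in> pencil p" "b' \<in> pencil p" "b \<noteq> b'" "sig h (Inr b) = sig h (Inr b')"
      using blocks_unseparated[OF p probes[of h]] unfolding sig_def by auto
    let ?h = "h @ [sig h (Inr b)]"
    obtain x y where xy: "x \<in> b \<union> b'" "y \<in> b \<union> b'" "x \<noteq> y" "sig ?h (Inl x) = sig ?h (Inl y)"
      using points_unseparated[OF b(1-3) probes[of ?h]] unfolding sig_def by auto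
    show ?thesis
    \<comment> \<open>The robber must reach \<open>x\<close> from the block he takes. If
      \<open>x\<close> is not on \<open>b\<close>, the two blocks swap roles; as their answers
      agree, \<open>?h\<close> is unaffected.\<close>
    proof (cases "x \<in> b")
      case True
      show ?thesis
        by (rule exI[of _ "(b, b', x, y)"]) (use b xy True in \<open>auto simp: good_def\<close>)
    next
      case False
      show ?thesis
        by (rule exI[of _ "(b', b, x, y)"]) (use b xy False in \<open>auto simp: good_def\<close>)
    qed
  qed
  define t where "t h p = (SOME t. good h p t)" for h p
  define b where "b h p = fst (t h p)" for h p
  define b' where "b' h p = fst (snd (t h p))" for h p
  define f where "f h p = fst (snd (snd (t h p)))" for h p
  define g where "g h p = snd (snd (snd (t h p)))" for h p
  have round:
    "b h p \<in> pencil p \<and> b' h p \<in> pencil p \<and> b h p \<noteq> b' h p \<and>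
      f h p \<in> b h p \<and> g h p \<in> b h p \<union> b' h p \<and> f h p \<noteq> g h p \<and>
      sig h (Inr (b h p)) = sig h (Inr (b' h p)) \<and>
      sig (h @ [sig h (Inr (b h p))]) (Inl (f h p)) = sig (h @ [sig h (Inr (b h p))]) (Inl (g h p))"
    if "p \<in> X" for h p
  proof -
    have "good h p (t h p)" unfolding t_def by (rule someI_ex[OF ex[OF that]])
    then show ?thesis
      unfolding good_def b_def b'_def f_def g_def case_prod_beta .
  qed
  obtain p0 where p0: "p0 \<in> X" using points_nonempty by blast
  \<comment> \<open>One step covers two rounds, with the robber first on a block and then on a
    point, and records both answers.\<close>
  define st where "st = rec_nat ([], p0) (\<lambda>_ (h, p).
    (h @ [sig h (Inr (b h p)), sig (h @ [sig h (Inr (b h p))]) (Inl (f h p))], f h p))"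
  define H where "H n = fst (st n)" for n
  define p where "p n = snd (st n)" for n
  define B where "B n = b (H n) (p n)" for n
  define B' where "B' n = b' (H n) (p n)" for n
  define q where "q n = g (H n) (p n)" for n
  have p_Suc: "p (Suc n) = f (H n) (p n)" for n
    by (simp add: p_def H_def st_def case_prod_beta)
  have H_0: "H 0 = []" by (simp add: H_def st_def)
  have H_Suc: "H (Suc n) = H n @ [sig (H n) (Inr (B n)),
      sig (H n @ [sig (H n) (Inr (B n))]) (Inl (p (Suc n)))]" for n
    unfolding p_Suc by (simp add: p_def H_def B_def st_def case_prod_beta)
  have pX: "p n \<in> X" for n
  proof (induction n)
    case 0
    then show ?case using p0 by (simp add: p_def st_def)
  next
    case (Suc n)
    then show ?case using round[OF Suc] block_subset unfolding p_Suc pencil_def by blast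
  qed
  have BB: "B n \<in> \<B>" "B' n \<in> \<B>" "B n \<noteq> B' n" "p n \<in> B n" "p n \<in> B' n" "p (Suc n) \<in> B n"
    "q n \<in> B n \<union> B' n" "p (Suc n) \<noteq> q n" "sig (H n) (Inr (B n)) = sig (H n) (Inr (B' n))"
    "sig (H n @ [sig (H n) (Inr (B n))]) (Inl (p (Suc n))) =
      sig (H n @ [sig (H n) (Inr (B n))]) (Inl (q n))" for n
    using round[OF pX[of n], of "H n"] unfolding B_def B'_def q_def p_Suc pencil_def by auto
  have qX: "q n \<in> X" for n using BB(1,2,7)[of n] block_subset by blast
  \<comment> \<open>The point \<open>p0\<close> is only a pivot for choosing \<open>B 0\<close> and
    \<open>B' 0\<close>; the robber starts on the block \<open>B 0\<close>.\<close>
  define r where "r i = (if even i then Inr (B (i div 2)) else Inl (p (Suc (i div 2))))" for i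
  have r: "r (2 * n) = Inr (B n)" "r (Suc (2 * n)) = Inl (p (Suc n))" for n
    by (simp_all add: r_def)
  have r_step: "(r i, r (Suc i)) \<in> E" for i
  proof (cases "even i")
    case True
    then obtain n where "i = 2 * n" by (elim evenE)
    then show ?thesis using r BB edge_iff by simp
  next
    case False
    then obtain n where "i = Suc (2 * n)" by (metis oddE Suc_eq_plus1)
    then show ?thesis using r(1)[of "Suc n"] r(2)[of n] BB(1,4)[of "Suc n"] edge_iff by simp
  qed
  have r_mem: "r i \<in> V" for i
    using BB(1) pX by (auto simp: r_def)
  have ans: "answers E \<sigma> r (2 * n) = H n" for n
  proof (induction n)
    case 0
    then show ?case by (simp add: H_0)
  next
    case (Suc n)
    then show ?case by (simp add: r H_Suc sig_def)
  qed
  have "robber_trajectory V E r"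
    using r_step r_mem by (simp add: robber_trajectory_def)
  then obtain i where i: "located V E \<sigma> r i" using win by blast
  show False
  proof (cases "even i")
    case True
    then obtain n where n: "i = 2 * n" by (elim evenE)
    \<comment> \<open>The decoy is on \<open>B' n\<close> instead of \<open>B n\<close> from round
      \<open>2 * n\<close> on. Its move there is legal because both blocks contain
      \<open>p n\<close>.\<close>
    define r' where "r' j = (if j < 2 * n then r j else Inr (B' n))" for j
    have "robber_trajectory V E r'"
      unfolding robber_trajectory_def
    proof (intro conjI allI)
      show "r' j \<in> V" for j using r_mem BB(2) by (auto simp: r'_def)
      fix j
      consider "Suc j < 2 * n" | "Suc j = 2 * n" | "2 * n \<le> j" by linarith
      then show "r' (Suc j) = r' j \<or> (r' j, r' (Suc j)) \<in> E"
      proof cases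
        case 1
        then show ?thesis using r_step by (simp add: r'_def)
      next
        case 2
        then obtain n' where n': "n = Suc n'" by (cases n) auto
        then have "j = Suc (2 * n')" using 2 by simp
        then show ?thesis using r(2)[of n'] BB(2,5)[of n] n' edge_iff by (simp add: r'_def)
      qed (simp add: r'_def)
    qed
    moreover have "answers E \<sigma> r' (2 * n) = H n"
      using answers_cong[of "2 * n" r' r E \<sigma>] ans by (simp add: r'_def)
    then have "answers E \<sigma> r' (Suc i) = answers E \<sigma> r (Suc i)"
      using BB(9)[of n] ans[of n] r(1)[of n] unfolding n by (simp add: sig_def r'_def)
    ultimately have "r' i = r i" using i unfolding located_def by blast
    then show False using BB(3)[of n] r(1)[of n] n by (simp add: r'_def)
  next
    case False
    then obtain n where n: "i = Suc (2 * n)" by (metis oddE Suc_eq_plus1)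
    \<comment> \<open>\<open>q n\<close> may lie on either block, and the decoy passes through one
      that contains it; in round \<open>2 * n\<close> both blocks give the same answer.\<close>
    obtain d where d: "d \<in> {B n, B' n}" "q n \<in> d" using BB(7)[of n] by blast
    have d': "d \<in> \<B>" "p n \<in> d" "sig (H n) (Inr d) = sig (H n) (Inr (B n))"
      using d(1) BB(1,2,4,5,9)[of n] by auto
    define r' where
      "r' j = (if j < 2 * n then r j else if j = 2 * n then Inr d else Inl (q n))" for j
    have "robber_trajectory V E r'"
      unfolding robber_trajectory_def
    proof (intro conjI allI)
      show "r' j \<in> V" for j using r_mem d'(1) qX by (auto simp: r'_def)
      fix j
      consider "Suc j < 2 * n" | "Suc j = 2 * n" | "j = 2 * n" | "2 * n < j" by linarith
      then show "r' (Suc j) = r' j \<or> (r' j, r' (Suc j)) \<in> E"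
      proof cases
        case 1
        then show ?thesis using r_step by (simp add: r'_def)
      next
        case 2
        then obtain n' where n': "n = Suc n'" by (cases n) auto
        then have "j = Suc (2 * n')" using 2 by simp
        then show ?thesis using r(2)[of n'] d' n' edge_iff by (simp add: r'_def)
      next
        case 3
        then show ?thesis using d d' edge_iff by (simp add: r'_def)
      qed (simp add: r'_def)
    qed
    moreover have "answers E \<sigma> r' (2 * n) = H n"
      using answers_cong[of "2 * n" r' r E \<sigma>] ans by (simp add: r'_def)
    then have "answers E \<sigma> r' (Suc (2 * n)) = H n @ [sig (H n) (Inr (B n))]"
      using d'(3) by (simp add: sig_def r'_def)
    moreover have "answers E \<sigma> r (Suc (2 * n)) = H n @ [sig (H n) (Inr (B n))]"
      using ans[of n] r(1)[of n] by (simp add: sig_def)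
    ultimately have "answers E \<sigma> r' (Suc i) = answers E \<sigma> r (Suc i)"
      using BB(10)[of n] r(2)[of n] unfolding n answers.simps(2)[of _ _ _ "Suc _"]
      by (simp add: sig_def r'_def del: answers.simps)
    with \<open>robber_trajectory V E r'\<close> have "r' i = r i" using i unfolding located_def by blast
    then show False using BB(8)[of n] r(2)[of n] n by (simp add: r'_def)
  qed
qed

end

theorem theorem3p5:
  fixes k :: nat and X :: "'a set" and \<B> :: "'a set set"
  assumes "affine_plane k X \<B>" and "k \<ge> 3"
  shows "localization_number (X <+> \<B>) (incidence_edges X \<B>) = k"
proof -
  interpret affine_plane_order k X \<B>
    using assms by unfold_locales auto
  show ?thesis
    unfolding localization_number_def
  proof (rule Least_equality)
    show "cops_win V E k" by (rule order_many_cops_win)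
    show "k \<le> m" if "cops_win V E m" for m
      using few_cops_lose[of m] that by (cases "m < k") auto
  qed
qed

end
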